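(* Let $K$ be an infinite field. There exists a linear subspace $\mathcal{X}$ of matrices over $K$ (i.e. $\mathcal{X}\subseteq\operatorname{Mat}_{k,l}(K)$ for some $k,l$) such that $$\frac{\operatorname{rk}(\mathcal{X}^{\{2\}})}{2} > \frac{\operatorname{rk}(\mathcal{X}^{\{3\}})}{3}.$$
   Context: $\operatorname{Mat}_{k,l}(K)$ is the space of $k\times l$ matrices over $K$. For a linear subspace $\mathcal{X}$ of matrices, $\operatorname{rk}(\mathcal{X})$ denotes the maximal rank among its members. For $d\ge 1$, the tensor blow-up is $\mathcal{X}^{\{d\}}=\mathcal{X}\otimes \operatorname{Mat}_{d,d}(K)=\{\sum_i X_i\otimes T_i \mid X_i\in\mathcal{X},\ T_i\in\operatorname{Mat}_{d,d}(K)\}$, viewed (via the Kronecker product) as a linear subspace of $\operatorname{Mat}_{kd,ld}(K)$. *)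

theory Defs
  imports Complex_Main "Jordan_Normal_Form.DL_Rank"
begin

definition kronecker :: "'a::semiring_1 mat \<Rightarrow> 'a mat \<Rightarrow> 'a mat" (infixl "\<otimes>\<^sub>K" 70)
  where "A \<otimes>\<^sub>K B = mat (dim_row A * dim_row B) (dim_col A * dim_col B)
    (\<lambda>(i, j). A $$ (i div dim_row B, j div dim_col B) * B $$ (i mod dim_row B, j mod dim_col B))"

(* vec_space.rank takes the number of rows as an extra argument.  The ranks of matrices of
   one fixed size are bounded, so the Max below is over a finite set, nonempty for a subspace. *)
definition max_rank :: "'a::field mat set \<Rightarrow> nat"
  where "max_rank \<X> = Max ((\<lambda>A. vec_space.rank (dim_row A) A) ` \<X>)"

abbreviation linear_subspace_of_matrices :: "nat \<Rightarrow> nat \<Rightarrow> 'a::field mat set \<Rightarrow> bool"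
  where "linear_subspace_of_matrices k l \<X> \<equiv>
    VectorSpace.subspace class_ring \<X> (module_mat TYPE('a) k l)"

(* The type 'a mat has no global addition with zero, so the sum is taken in the module of
   (k * d) x (l * d) matrices. *)
definition blow_up :: "nat \<Rightarrow> nat \<Rightarrow> nat \<Rightarrow> 'a::field mat set \<Rightarrow> 'a mat set"
  where "blow_up k l d \<X> =
    {finsum (module_mat TYPE('a) (k * d) (l * d)) (\<lambda>i. X i \<otimes>\<^sub>K T i) {..<n} | (n::nat) X T.
      (\<forall>i<n. X i \<in> \<X> \<and> T i \<in> carrier_mat d d)}"

end

theory Submission
  imports Defs "HOL-Library.Product_Plus"
begin

text \<open>
  A rational identity in two noncommuting variables that holds for $3 \times 3$ matrices but not for
  $2 \times 2$ matrices produces the required space.  Put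
  $$u = [A, B], \quad w = [u, A], \quad v = w^{-1} u w, \quad
    \kappa = v^2 (v + u) - u \bigl(u (v + u) + v u\bigr).$$

  For $3 \times 3$ matrices \<open>\<kappa>\<close> is scalar.  Indeed \<open>u\<close> has trace zero, so $u^3 + \sigma u = \delta$ by
  Cayley--Hamilton; the commutator of this equation with \<open>A\<close>, divided by \<open>w\<close>, is
  $u^2 + v u + v^2 = -\sigma$; its trace is $\mathrm{tr}(u v) = \sigma$; and the polarised
  Cayley--Hamilton equation for the pair $(u, v)$ then gives $\kappa = -\delta - \delta_1$ with
  \<open>\<delta>\<^sub>1\<close> the scalar on its right hand side.  This is \<open>degree_three_identity\<close>.
  For $2 \times 2$ matrices, in contrast, \<open>w\<close> anticommutes with \<open>u\<close>, because
  \<open>u\<close>, \<open>w\<close> and \<open>u w\<close> have trace zero; so $v = -u$ and $\kappa = u^3$.  With $A = E_{11}$ and \<open>B\<close> the swap of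
  coordinates, $u^2 = -1$, so $\kappa = -u$ does not commute with \<open>A\<close>, over any field.

  The equation $\kappa A y = A \kappa y$, with auxiliary unknowns in place of the inverses of \<open>w\<close>, is
  a square system of homogeneous linear equations with noncommutative polynomials in \<open>A\<close>, \<open>B\<close> as
  coefficients.  It always has a nonzero solution for $3 \times 3$ matrices, and only the zero solution
  for the $2 \times 2$ matrices above (\<open>three_by_three_solution\<close>, \<open>two_by_two_solution_trivial\<close>).  One more unknown for every subexpression (Higman's linearisation
  trick), and a third variable \<open>X\<^sub>0\<close> that stands for the identity matrix, turn the system into one
  whose coefficients are linear forms in $X_0, X_1, X_2$.  The three coefficient matrices, of size
  \<open>M\<close>, span a space of matrices whose blow-up of degree $d$ consists of the coefficient matrices of the
  system at all triples of $d \times d$ matrices (\<open>blow_up_pencil_space\<close>).  So the blow-up of degree 2 has maximal rank \<open>2M\<close>,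
  while the blow-up of degree 3 has maximal rank below \<open>3M\<close>.
\<close>

section \<open>Blow-ups of the span of finitely many matrices\<close>

text \<open>A pencil is given by the entries \<open>c l r s\<close> of \<open>m\<close> coefficient matrices, and a point \<open>T\<close> by the
  entries \<open>T l p q\<close> of \<open>m\<close> matrices of size \<open>d\<close>; both are functions, total in their indices, so that no
  carrier conditions arise.\<close>

definition pencil_space :: "nat \<Rightarrow> nat \<Rightarrow> (nat \<Rightarrow> nat \<Rightarrow> nat \<Rightarrow> 'a::field) \<Rightarrow> 'a mat set" where
  "pencil_space m N c = {mat N N (\<lambda>(r, s). \<Sum>l<m. \<alpha> l * c l r s) | \<alpha>. True}"

definition pencil_at ::
  "nat \<Rightarrow> nat \<Rightarrow> (nat \<Rightarrow> nat \<Rightarrow> nat \<Rightarrow> 'a::field) \<Rightarrow> nat \<Rightarrow> (nat \<Rightarrow> nat \<Rightarrow> nat \<Rightarrow> 'a) \<Rightarrow> 'a mat" where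
  "pencil_at m N c d T = mat (N * d) (N * d)
    (\<lambda>(i, j). \<Sum>l<m. c l (i div d) (j div d) * T l (i mod d) (j mod d))"

lemma pencil_at_carrier [simp]: "pencil_at m N c d T \<in> carrier_mat (N * d) (N * d)"
  by (simp add: pencil_at_def)

lemma linear_subspace_pencil_space: "linear_subspace_of_matrices N N (pencil_space m N c)"
proof -
  interpret V: vectorspace class_ring "module_mat TYPE('a) N N"
    by (rule matrix_vs)
  have "submodule class_ring (pencil_space m N c) (module_mat TYPE('a) N N)"
  proof (rule LinearCombinations.submodule.intro)
    show "module class_ring (module_mat TYPE('a) N N)" by (rule V.module_axioms)
    show "pencil_space m N c \<subseteq> carrier (module_mat TYPE('a) N N)"
      by (auto simp: pencil_space_def module_mat_simps)
    show "\<zero>\<^bsub>module_mat TYPE('a) N N\<^esub> \<in> pencil_space m N c"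
      unfolding pencil_space_def module_mat_simps
      by (rule CollectI, rule exI[of _ "\<lambda>_. 0"]) (auto intro!: eq_matI)
    show "A \<oplus>\<^bsub>module_mat TYPE('a) N N\<^esub> B \<in> pencil_space m N c"
      if "A \<in> pencil_space m N c" "B \<in> pencil_space m N c" for A B
    proof -
      from that obtain \<alpha> \<beta> where "A = mat N N (\<lambda>(r, s). \<Sum>l<m. \<alpha> l * c l r s)"
        "B = mat N N (\<lambda>(r, s). \<Sum>l<m. \<beta> l * c l r s)" by (auto simp: pencil_space_def)
      then have "A + B = mat N N (\<lambda>(r, s). \<Sum>l<m. (\<alpha> l + \<beta> l) * c l r s)"
        by (auto intro!: eq_matI simp: sum.distrib distrib_right)
      then show ?thesis by (auto simp: pencil_space_def module_mat_simps intro!: exI[of _ "\<lambda>l. \<alpha> l + \<beta> l"])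
    qed
    show "x \<odot>\<^bsub>module_mat TYPE('a) N N\<^esub> A \<in> pencil_space m N c"
      if "x \<in> carrier class_ring" "A \<in> pencil_space m N c" for x A
    proof -
      from that obtain \<alpha> where "A = mat N N (\<lambda>(r, s). \<Sum>l<m. \<alpha> l * c l r s)"
        by (auto simp: pencil_space_def)
      then have "x \<cdot>\<^sub>m A = mat N N (\<lambda>(r, s). \<Sum>l<m. (x * \<alpha> l) * c l r s)"
        by (auto intro!: eq_matI simp: sum_distrib_left mult.assoc)
      then show ?thesis by (auto simp: pencil_space_def module_mat_simps intro!: exI[of _ "\<lambda>l. x * \<alpha> l"])
    qed
  qed
  then show ?thesis by (simp add: VectorSpace.subspace_def V.vectorspace_axioms)
qed

lemma finsum_module_mat:
  fixes f :: "nat \<Rightarrow> 'a::field mat"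
  assumes "\<And>k. k < n \<Longrightarrow> f k \<in> carrier_mat p q"
  shows "finsum (module_mat TYPE('a) p q) f {..<n} = mat p q (\<lambda>ij. \<Sum>k<n. f k $$ ij)"
  using assms
proof (induction n)
  interpret V: abelian_group "module_mat TYPE('a) p q" by (rule abelian_group_mat)
  case 0
  then show ?case by (auto simp: module_mat_simps intro!: eq_matI)
next
  interpret V: abelian_group "module_mat TYPE('a) p q" by (rule abelian_group_mat)
  case (Suc n)
  have "finsum (module_mat TYPE('a) p q) f {..<Suc n}
      = f n + finsum (module_mat TYPE('a) p q) f {..<n}"
    unfolding lessThan_Suc
    by (subst V.finsum_insert) (auto simp: module_mat_simps intro!: Suc.prems)
  also have "\<dots> = f n + mat p q (\<lambda>ij. \<Sum>k<n. f k $$ ij)" using Suc by simp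
  also have "\<dots> = mat p q (\<lambda>ij. \<Sum>k<Suc n. f k $$ ij)"
    using Suc.prems[of n] by (auto intro!: eq_matI)
  finally show ?case .
qed

text \<open>Every sum of Kronecker products $\sum_i X_i \otimes T_i$ is a value of the pencil because
  the coefficients of \<open>X\<^sub>i\<close> in terms of the spanning matrices can be moved into the second factor; conversely
  the value at \<open>T\<close> is $\sum_l C_l \otimes T_l$ with \<open>C\<^sub>l\<close> the coefficient matrices.\<close>

lemma blow_up_pencil_space:
  "blow_up N N d (pencil_space m N c) = range (pencil_at m N c d)"
proof (intro equalityI subsetI)
  fix Z assume "Z \<in> blow_up N N d (pencil_space m N c)"
  then obtain n :: nat and X T where Z: "Z = finsum (module_mat TYPE('a) (N * d) (N * d)) (\<lambda>i. X i \<otimes>\<^sub>K T i) {..<n}"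
    and XT: "\<forall>i<n. X i \<in> pencil_space m N c \<and> T i \<in> carrier_mat d d"
    unfolding blow_up_def mem_Collect_eq by (elim exE conjE)
  have X: "\<And>i. i < n \<Longrightarrow> X i \<in> pencil_space m N c"
    and T: "\<And>i. i < n \<Longrightarrow> T i \<in> carrier_mat d d"
    using XT by simp_all
  have "\<forall>i. \<exists>\<alpha>. i < n \<longrightarrow> X i = mat N N (\<lambda>(r, s). \<Sum>l<m. \<alpha> l * c l r s)"
    using X unfolding pencil_space_def by blast
  from choice[OF this] obtain \<alpha>
    where \<alpha>: "\<And>i. i < n \<Longrightarrow> X i = mat N N (\<lambda>(r, s). \<Sum>l<m. \<alpha> i l * c l r s)"
    by blast
  have kron: "X i \<otimes>\<^sub>K T i = mat (N * d) (N * d)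
      (\<lambda>(a, b). (\<Sum>l<m. \<alpha> i l * c l (a div d) (b div d)) * T i $$ (a mod d, b mod d))" if "i < n" for i
  proof -
    have dims: "dim_row (T i) = d" "dim_col (T i) = d" "dim_row (X i) = N" "dim_col (X i) = N"
      using T[OF that] by (simp_all add: \<alpha>[OF that])
    show ?thesis
      unfolding kronecker_def dims
      by (rule cong_mat) (simp_all add: \<alpha>[OF that] less_mult_imp_div_less)
  qed
  have swap: "(\<Sum>k<n. (\<Sum>l<m. \<alpha> k l * x l) * y k) = (\<Sum>l<m. x l * (\<Sum>k<n. \<alpha> k l * y k))"
    for x y
    unfolding sum_distrib_left sum_distrib_right
    by (subst sum.swap) (simp add: mult_ac)
  have "Z = pencil_at m N c d (\<lambda>l p q. \<Sum>i<n. \<alpha> i l * T i $$ (p, q))"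
    unfolding Z
  proof (subst finsum_module_mat)
    show "mat (N * d) (N * d) (\<lambda>ij. \<Sum>k<n. (X k \<otimes>\<^sub>K T k) $$ ij) =
      pencil_at m N c d (\<lambda>l p q. \<Sum>i<n. \<alpha> i l * T i $$ (p, q))"
      unfolding pencil_at_def
    proof (rule cong_mat)
      fix a b assume "a < N * d" "b < N * d"
      then have "(\<Sum>k<n. (X k \<otimes>\<^sub>K T k) $$ (a, b))
          = (\<Sum>k<n. (\<Sum>l<m. \<alpha> k l * c l (a div d) (b div d)) * T k $$ (a mod d, b mod d))"
        by (intro sum.cong) (simp_all add: kron)
      also have "\<dots> = (\<Sum>l<m. c l (a div d) (b div d) * (\<Sum>k<n. \<alpha> k l * T k $$ (a mod d, b mod d)))"
        by (rule swap)
      finally show "(\<Sum>k<n. (X k \<otimes>\<^sub>K T k) $$ (a, b)) = (case (a, b) of (i, j) \<Rightarrow>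
          \<Sum>l<m. c l (i div d) (j div d) * (\<Sum>k<n. \<alpha> k l * T k $$ (i mod d, j mod d)))"
        by simp
    qed simp_all
  qed (simp add: kron)
  then show "Z \<in> range (pencil_at m N c d)" by blast
next
  fix Z assume "Z \<in> range (pencil_at m N c d)"
  then obtain T where Z: "Z = pencil_at m N c d T" by blast
  define X where "X k = mat N N (\<lambda>(r, s). \<Sum>l<m. (if l = k then 1 else 0) * c l r s)" for k
  define S where "S k = mat d d (\<lambda>(p, q). T k p q)" for k
  have X: "X k \<in> pencil_space m N c" for k
    unfolding X_def pencil_space_def
    by (rule CollectI, rule exI[of _ "\<lambda>l. if l = k then 1 else 0"]) simp
  have Xe: "X k $$ (r, s) = c k r s" if "k < m" "r < N" "s < N" for k r s
    using that by (simp add: X_def if_distrib[of "\<lambda>x. x * _"] cong: if_cong)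
  have kron: "X k \<otimes>\<^sub>K S k = mat (N * d) (N * d)
      (\<lambda>(a, b). c k (a div d) (b div d) * T k (a mod d) (b mod d))" if "k < m" for k
  proof -
    have dims: "dim_row (S k) = d" "dim_col (S k) = d" "dim_row (X k) = N" "dim_col (X k) = N"
      by (simp_all add: S_def X_def)
    have "p mod d < d" if "p < N * d" for p using that by (cases "d = 0") auto
    then show ?thesis
      unfolding kronecker_def dims
      by (intro cong_mat) (simp_all add: Xe that less_mult_imp_div_less S_def)
  qed
  have "Z = finsum (module_mat TYPE('a) (N * d) (N * d)) (\<lambda>k. X k \<otimes>\<^sub>K S k) {..<m}"
    unfolding Z
    by (subst finsum_module_mat) (auto simp: kron pencil_at_def intro!: cong_mat sum.cong)
  moreover have "\<forall>k<m. X k \<in> pencil_space m N c \<and> S k \<in> carrier_mat d d"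
    using X by (simp add: S_def)
  ultimately show "Z \<in> blow_up N N d (pencil_space m N c)"
    unfolding blow_up_def by blast
qed

lemma max_rank_square:
  fixes \<Y> :: "'a::field mat set"
  assumes "\<Y> \<subseteq> carrier_mat n n" "\<Y> \<noteq> {}"
  shows "max_rank \<Y> \<le> n" and "max_rank \<Y> = n \<longleftrightarrow> (\<exists>A\<in>\<Y>. det A \<noteq> 0)"
proof -
  define rk :: "'a mat \<Rightarrow> nat" where "rk = (\<lambda>A. vec_space.rank (dim_row A) A)"
  have rk: "rk A \<le> n" "det A \<noteq> 0 \<longleftrightarrow> rk A = n" if "A \<in> \<Y>" for A
  proof -
    have A: "A \<in> carrier_mat n n" using that assms(1) by blast
    have rk: "rk A = vec_space.rank n A" unfolding rk_def carrier_matD(1)[OF A] by (rule refl)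
    show "rk A \<le> n" unfolding rk by (rule vec_space.rank_le_nc[OF A])
    show "det A \<noteq> 0 \<longleftrightarrow> rk A = n" unfolding rk by (rule vec_space.det_rank_iff[OF A])
  qed
  have fin: "finite (rk ` \<Y>)" by (rule finite_subset[of _ "{..n}"]) (use rk(1) in auto)
  have max_rank: "max_rank \<Y> = Max (rk ` \<Y>)" unfolding max_rank_def rk_def by (rule refl)
  have "max_rank \<Y> \<in> rk ` \<Y>"
    unfolding max_rank by (rule Max_in[OF fin]) (simp add: assms(2))
  then obtain A where A: "A \<in> \<Y>" "max_rank \<Y> = rk A" by blast
  then show le: "max_rank \<Y> \<le> n" using rk(1) by simp
  have ge: "rk A \<le> max_rank \<Y>" if "A \<in> \<Y>" for A
    unfolding max_rank using fin that by (intro Max_ge) auto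
  show "max_rank \<Y> = n \<longleftrightarrow> (\<exists>A\<in>\<Y>. det A \<noteq> 0)"
  proof
    assume "max_rank \<Y> = n"
    then show "\<exists>A\<in>\<Y>. det A \<noteq> 0" using A rk(2)[OF A(1)] by (intro bexI[of _ A]) auto
  next
    assume "\<exists>A\<in>\<Y>. det A \<noteq> 0"
    then obtain B where "B \<in> \<Y>" "rk B = n" using rk(2) by blast
    then show "max_rank \<Y> = n" using le ge[of B] by simp
  qed
qed

text \<open>A kernel vector of a value of the pencil is split into \<open>N\<close> blocks of length \<open>d\<close>, one for each
  unknown of the system of equations that the pencil encodes.\<close>

lemma det_pencil_at_eq_0_iff:
  "det (pencil_at m N c d T) = 0 \<longleftrightarrow>
    (\<exists>V. (\<exists>s<N. \<exists>p<d. V s p \<noteq> 0) \<and>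
      (\<forall>r<N. \<forall>p<d. (\<Sum>s<N. \<Sum>l<m. c l r s * (\<Sum>q<d. T l p q * V s q)) = 0))"
proof -
  have block: "(\<Sum>j<N * d. g j) = (\<Sum>s<N. \<Sum>q<d. g (s * d + q))" for g :: "nat \<Rightarrow> 'a"
  proof -
    have "sum g {s * d..<s * d + d} = (\<Sum>q<d. g (s * d + q))" for s
      using sum.shift_bounds_nat_ivl[of g 0 "s * d" d] by (simp add: lessThan_atLeast0 add.commute)
    then show ?thesis by (simp flip: sum.nat_group)
  qed
  have split: "s * d + q < N * d" if "s < N" "q < d" for s q
  proof -
    have "s * d + q < (s + 1) * d" using that by simp
    also have "\<dots> \<le> N * d" using that by (intro mult_right_mono) auto
    finally show ?thesis .
  qed
  have entry: "(pencil_at m N c d T *\<^sub>v x) $ (r * d + p)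
      = (\<Sum>s<N. \<Sum>l<m. c l r s * (\<Sum>q<d. T l p q * x $ (s * d + q)))"
    if "r < N" "p < d" "x \<in> carrier_vec (N * d)" for x r p
  proof -
    have "(pencil_at m N c d T *\<^sub>v x) $ (r * d + p)
        = (\<Sum>j<N * d. (\<Sum>l<m. c l r (j div d) * T l p (j mod d)) * x $ j)"
      using that split[of r p] by (simp add: pencil_at_def scalar_prod_def lessThan_atLeast0)
    also have "\<dots> = (\<Sum>s<N. \<Sum>q<d. (\<Sum>l<m. c l r s * T l p q) * x $ (s * d + q))"
      using that by (simp add: block)
    also have "\<dots> = (\<Sum>s<N. \<Sum>l<m. c l r s * (\<Sum>q<d. T l p q * x $ (s * d + q)))"
    proof (rule sum.cong[OF refl])
      fix s
      show "(\<Sum>q<d. (\<Sum>l<m. c l r s * T l p q) * x $ (s * d + q))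
          = (\<Sum>l<m. c l r s * (\<Sum>q<d. T l p q * x $ (s * d + q)))"
        unfolding sum_distrib_left sum_distrib_right
        by (subst sum.swap) (simp add: mult.assoc)
    qed
    finally show ?thesis .
  qed
  have div: "i div d < N" "i mod d < d" if "i < N * d" for i
    using that by (cases "d = 0"; simp add: less_mult_imp_div_less)+
  show ?thesis
    unfolding det_0_iff_vec_prod_zero_field[OF pencil_at_carrier]
  proof
    assume "\<exists>x. x \<in> carrier_vec (N * d) \<and> x \<noteq> 0\<^sub>v (N * d) \<and> pencil_at m N c d T *\<^sub>v x = 0\<^sub>v (N * d)"
    then obtain x where x: "x \<in> carrier_vec (N * d)" "x \<noteq> 0\<^sub>v (N * d)"
      "pencil_at m N c d T *\<^sub>v x = 0\<^sub>v (N * d)" by blast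
    then obtain i where "i < N * d" "x $ i \<noteq> 0" by (metis carrier_vecD eq_vecI index_zero_vec)
    then have nz: "x $ (i div d * d + i mod d) \<noteq> 0" by simp
    have sol: "(\<Sum>s<N. \<Sum>l<m. c l r s * (\<Sum>q<d. T l p q * x $ (s * d + q))) = 0"
      if "r < N" "p < d" for r p
    proof -
      have "(pencil_at m N c d T *\<^sub>v x) $ (r * d + p) = 0"
        unfolding x(3) using split[OF that] by (rule index_zero_vec(1))
      then show ?thesis using entry[OF that x(1)] by (rule trans[OF sym, rotated])
    qed
    show "\<exists>V. (\<exists>s<N. \<exists>p<d. V s p \<noteq> 0) \<and>
      (\<forall>r<N. \<forall>p<d. (\<Sum>s<N. \<Sum>l<m. c l r s * (\<Sum>q<d. T l p q * V s q)) = 0)"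
    proof (intro exI[of _ "\<lambda>s q. x $ (s * d + q)"] conjI)
      show "\<exists>s<N. \<exists>q<d. x $ (s * d + q) \<noteq> 0"
        using div[OF \<open>i < N * d\<close>] nz by blast
      show "\<forall>r<N. \<forall>p<d. (\<Sum>s<N. \<Sum>l<m. c l r s * (\<Sum>q<d. T l p q * x $ (s * d + q))) = 0"
        using sol by blast
    qed
  next
    assume "\<exists>V. (\<exists>s<N. \<exists>p<d. V s p \<noteq> 0) \<and>
      (\<forall>r<N. \<forall>p<d. (\<Sum>s<N. \<Sum>l<m. c l r s * (\<Sum>q<d. T l p q * V s q)) = 0)"
    then obtain V s p where V: "s < N" "p < d" "V s p \<noteq> 0"
      "\<And>r p. r < N \<Longrightarrow> p < d \<Longrightarrow> (\<Sum>s<N. \<Sum>l<m. c l r s * (\<Sum>q<d. T l p q * V s q)) = 0" by blast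
    define x where "x = vec (N * d) (\<lambda>i. V (i div d) (i mod d))"
    have x: "x \<in> carrier_vec (N * d)" by (simp add: x_def)
    have xs: "x $ (s * d + q) = V s q" if "s < N" "q < d" for s q
      using that split by (simp add: x_def)
    have "x \<noteq> 0\<^sub>v (N * d)" using xs[OF V(1,2)] V(3) split[OF V(1,2)] by auto
    moreover have "pencil_at m N c d T *\<^sub>v x = 0\<^sub>v (N * d)"
    proof (rule eq_vecI)
      fix i assume "i < dim_vec (0\<^sub>v (N * d))"
      then have i: "i < N * d" by simp
      have "(pencil_at m N c d T *\<^sub>v x) $ (i div d * d + i mod d) = 0"
        unfolding entry[OF div[OF i] x] using V(4)[OF div[OF i]] by (simp add: xs)
      then show "(pencil_at m N c d T *\<^sub>v x) $ i = 0\<^sub>v (N * d) $ i" using i by simp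
    qed (simp add: pencil_at_def)
    ultimately show "\<exists>x. x \<in> carrier_vec (N * d) \<and> x \<noteq> 0\<^sub>v (N * d) \<and> pencil_at m N c d T *\<^sub>v x = 0\<^sub>v (N * d)"
      using x by blast
  qed
qed

lemma blow_up_rank_gap:
  fixes c :: "nat \<Rightarrow> nat \<Rightarrow> nat \<Rightarrow> 'a::field"
  assumes "det (pencil_at m N c 2 T) \<noteq> 0" and "\<And>T. det (pencil_at m N c 3 T) = 0"
  shows "real (max_rank (blow_up N N 2 (pencil_space m N c))) / 2
       > real (max_rank (blow_up N N 3 (pencil_space m N c))) / 3"
proof -
  have sub: "range (pencil_at m N c d) \<subseteq> carrier_mat (N * d) (N * d)"
    and ne: "range (pencil_at m N c d) \<noteq> {}" for d by auto
  have "max_rank (blow_up N N 2 (pencil_space m N c)) = N * 2"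
    unfolding blow_up_pencil_space max_rank_square(2)[OF sub ne] using assms(1) by blast
  moreover have "max_rank (blow_up N N 3 (pencil_space m N c)) \<noteq> N * 3"
    unfolding blow_up_pencil_space max_rank_square(2)[OF sub ne] using assms(2) by blast
  moreover have "max_rank (blow_up N N 3 (pencil_space m N c)) \<le> N * 3"
    unfolding blow_up_pencil_space by (rule max_rank_square(1)[OF sub ne])
  ultimately show ?thesis by simp
qed

section \<open>Linearisation of systems of noncommutative equations\<close>

text \<open>Expressions denote vectors: \<open>Apply True\<close> and \<open>Apply False\<close> stand for the two operators
  \<open>A\<close> and \<open>B\<close>.\<close>

datatype expr = Unknown nat | Apply bool expr | Plus expr expr | Minus expr expr

fun eval :: "(bool \<Rightarrow> 'v \<Rightarrow> 'v) \<Rightarrow> (nat \<Rightarrow> 'v) \<Rightarrow> expr \<Rightarrow> 'v::ab_group_add" where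
  "eval f v (Unknown j) = v j"
| "eval f v (Apply b e) = f b (eval f v e)"
| "eval f v (Plus e e') = eval f v e + eval f v e'"
| "eval f v (Minus e e') = eval f v e - eval f v e'"

fun subexprs :: "expr \<Rightarrow> expr set" where
  "subexprs (Unknown j) = {Unknown j}"
| "subexprs (Apply b e) = insert (Apply b e) (subexprs e)"
| "subexprs (Plus e e') = insert (Plus e e') (subexprs e \<union> subexprs e')"
| "subexprs (Minus e e') = insert (Minus e e') (subexprs e \<union> subexprs e')"

text \<open>The unknowns of the linearised system, which also index its equations: a system of \<open>n\<close> equations
  \<open>C j = 0\<close> in \<open>n\<close> unknowns thus becomes square again.\<close>

definition nodes :: "nat \<Rightarrow> (nat \<Rightarrow> expr) \<Rightarrow> expr set" where
  "nodes n C = Unknown ` {..<n} \<union> (\<Union>j<n. subexprs (C j))"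

text \<open>The position among $X_0, X_1, X_2$ of the matrix that represents an operator; \<open>X\<^sub>0\<close> represents the
  identity.\<close>

definition slot :: "bool \<Rightarrow> nat" where "slot b = (if b then 1 else 2)"

text \<open>The equation of a compound expression defines its value from the values of its arguments.  The unknown
  \<open>j\<close> needs no defining equation, and its place is taken by the constraint \<open>C j = 0\<close>.  The argument
  \<open>Y l e\<close> stands for $X_l$ applied to the value of \<open>e\<close>.  All terms without an operator carry
  \<open>X\<^sub>0\<close>, which makes every equation homogeneous of degree one.\<close>

fun residual :: "(nat \<Rightarrow> expr) \<Rightarrow> (nat \<Rightarrow> expr \<Rightarrow> 'v) \<Rightarrow> expr \<Rightarrow> 'v::ab_group_add" where
  "residual C Y (Unknown j) = Y 0 (C j)"
| "residual C Y (Apply b e) = Y 0 (Apply b e) - Y (slot b) e"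
| "residual C Y (Plus e e') = Y 0 (Plus e e') - Y 0 e - Y 0 e'"
| "residual C Y (Minus e e') = Y 0 (Minus e e') - Y 0 e + Y 0 e'"

text \<open>The coefficient of \<open>Y l f\<close> in the equation \<open>e\<close>, read off by evaluating the equation at an indicator
  function.\<close>

definition coef :: "(nat \<Rightarrow> expr) \<Rightarrow> nat \<Rightarrow> expr \<Rightarrow> expr \<Rightarrow> 'a::ring_1" where
  "coef C l e f = residual C (\<lambda>l' f'. of_bool (l' = l \<and> f' = f)) e"

lemma finite_subexprs: "finite (subexprs e)"
  by (induction e) auto

lemma self_subexprs: "e \<in> subexprs e"
  by (cases e) auto

lemma subexprs_trans: "e \<in> subexprs e' \<Longrightarrow> subexprs e \<subseteq> subexprs e'"
  by (induction e') auto

lemma finite_nodes: "finite (nodes n C)"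
  by (simp add: nodes_def finite_subexprs)

lemma nodes_closed: "e \<in> nodes n C \<Longrightarrow> subexprs e \<subseteq> nodes n C"
  using subexprs_trans by (fastforce simp: nodes_def)

lemma nodes_args:
  "Apply b e \<in> nodes n C \<Longrightarrow> e \<in> nodes n C"
  "Plus e e' \<in> nodes n C \<Longrightarrow> e \<in> nodes n C \<and> e' \<in> nodes n C"
  "Minus e e' \<in> nodes n C \<Longrightarrow> e \<in> nodes n C \<and> e' \<in> nodes n C"
  using nodes_closed[of _ n C] self_subexprs by fastforce+

locale operator_system =
  fixes n :: nat and C :: "nat \<Rightarrow> expr"
  assumes bases: "\<And>j k. j < n \<Longrightarrow> Unknown k \<in> subexprs (C j) \<Longrightarrow> k < n"
    and pos: "n > 0"
begin

abbreviation "N \<equiv> nodes n C"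

lemma Unknown_node: "Unknown j \<in> N \<longleftrightarrow> j < n"
  using bases by (auto simp: nodes_def)

lemma constraint_node: "j < n \<Longrightarrow> C j \<in> N"
  using self_subexprs by (auto simp: nodes_def)

lemma residual_as_sum:
  fixes Y :: "nat \<Rightarrow> expr \<Rightarrow> 'a::ring_1"
  assumes "e \<in> N"
  shows "(\<Sum>f\<in>N. \<Sum>l<3. coef C l e f * Y l f) = residual C Y e"
proof -
  define \<delta> :: "nat \<Rightarrow> expr \<Rightarrow> nat \<Rightarrow> expr \<Rightarrow> 'a"
    where "\<delta> l' f' l f = of_bool (l' = l \<and> f' = f)" for l' f' l f
  have coef: "coef C l e f = residual C (\<lambda>l' f'. \<delta> l' f' l f) e" for l e f
    by (simp add: coef_def \<delta>_def)
  have pick: "(\<Sum>f\<in>N. \<Sum>l<3. \<delta> l' f' l f * Y l f) = Y l' f'" if "l' < 3" "f' \<in> N" for l' f'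
  proof -
    have "(\<Sum>l<3. \<delta> l' f' l f * Y l f) = (if f' = f then Y l' f else 0)" for f
      using that by (auto simp: \<delta>_def of_bool_def if_distrib[of "\<lambda>x. x * _"] cong: if_cong)
    then show ?thesis using that finite_nodes[of n C] by simp
  qed
  have slot: "slot b < 3" for b by (simp add: slot_def)
  note expand = coef left_diff_distrib distrib_right sum_subtractf sum.distrib
  show ?thesis
  proof (cases e)
    case (Unknown j)
    then show ?thesis using assms Unknown_node constraint_node[of j] by (simp add: expand pick)
  next
    case (Apply b e')
    then show ?thesis using assms nodes_args(1)[of b e'] by (simp add: expand pick slot)
  next
    case (Plus e1 e2)
    then show ?thesis using assms nodes_args(2)[of e1 e2] by (simp add: expand pick)
  next
    case (Minus e1 e2)
    then show ?thesis using assms nodes_args(3)[of e1 e2] by (simp add: expand pick)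
  qed
qed

lemma solution_imp_eval:
  assumes "\<And>e. e \<in> N \<Longrightarrow> residual C Y e = 0"
    and "\<And>e. Y 0 e = V e" "\<And>b e. Y (slot b) e = f b (V e)"
  shows "e \<in> N \<Longrightarrow> V e = eval f (\<lambda>j. V (Unknown j)) e"
    and "j < n \<Longrightarrow> eval f (\<lambda>j. V (Unknown j)) (C j) = 0"
proof -
  show *: "V e = eval f (\<lambda>j. V (Unknown j)) e" if "e \<in> N" for e
    using that
  proof (induction e)
    case (Apply b e)
    then show ?case using assms(1)[OF Apply.prems] nodes_args(1) by (simp add: assms(2,3))
  next
    case (Plus e1 e2)
    then show ?case using assms(1)[OF Plus.prems] nodes_args(2)[OF Plus.prems] by (simp add: assms(2) diff_diff_eq)
  next
    case (Minus e1 e2)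
    then show ?case using assms(1)[OF Minus.prems] nodes_args(3)[OF Minus.prems] by (simp add: assms(2) algebra_simps)
  qed simp
  show "eval f (\<lambda>j. V (Unknown j)) (C j) = 0" if "j < n"
    using assms(1)[of "Unknown j"] *[OF constraint_node[OF that]] that by (simp add: Unknown_node assms(2))
qed

text \<open>In the application \<open>g\<close> is multiplication by an invertible \<open>X\<^sub>0\<close>, and the operators are
  $X_0^{-1} X_1$ and $X_0^{-1} X_2$.\<close>

lemma eval_solution:
  assumes "\<And>j. j < n \<Longrightarrow> eval f v (C j) = 0"
    and "\<And>e. Y 0 e = g (eval f v e)" "\<And>b e. Y (slot b) e = g (f b (eval f v e))"
    and "\<And>x y. g (x + y) = g x + g y"
    and "e \<in> N"
  shows "residual C Y e = 0"
proof -
  interpret additive g by unfold_locales (rule assms(4))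
  show ?thesis
    using assms(1,5) by (cases e) (auto simp: assms(2,3) Unknown_node zero add diff)
qed

text \<open>If \<open>X\<^sub>0\<close> is singular, an element of its kernel can be placed at an expression of maximal size: this is not the
  argument of an operator in any equation, so it occurs only with \<open>X\<^sub>0\<close> in front.\<close>

lemma singular_homogeniser_solution:
  assumes "k \<noteq> 0" "g k = 0" and "\<And>l. h l 0 = 0" "h 0 = g"
  obtains V where "\<And>e. e \<in> N \<Longrightarrow> residual C (\<lambda>l e. h l (V e)) e = (0::'v::ab_group_add)"
    and "\<exists>e\<in>N. V e \<noteq> 0"
proof -
  have "N \<noteq> {}" using constraint_node pos by blast
  then obtain m where m: "m \<in> N" "\<And>e. e \<in> N \<Longrightarrow> size e \<le> size m"
  proof -
    have "Max (size ` N) \<in> size ` N" using finite_nodes \<open>N \<noteq> {}\<close> by (intro Max_in) auto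
    then obtain m where "m \<in> N" "size m = Max (size ` N)" by auto
    with that show thesis by (simp add: finite_nodes)
  qed
  let ?V = "\<lambda>e. if e = m then k else 0"
  have z: "h 0 (?V e) = 0" for e using assms(2) assms(3)[of 0] by (simp add: assms(4))
  have "residual C (\<lambda>l e. h l (?V e)) e = 0" if "e \<in> N" for e
  proof (cases e)
    case (Apply b e')
    then have "e' \<noteq> m" using m(2)[OF that] by auto
    then show ?thesis using Apply z assms(3) by simp
  qed (use z assms(3)[of 0] assms(4) in simp_all)
  then show ?thesis using that[of ?V] m(1) assms(1) by auto
qed

end

lemma (in operator_system) eval_zero:
  assumes "\<And>j. j < n \<Longrightarrow> v j = 0" and "\<And>b. f b 0 = 0"
  shows "e \<in> N \<Longrightarrow> eval f v e = 0"
proof (induction e)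
  case (Unknown j)
  then show ?case by (simp add: assms(1) Unknown_node)
qed (auto simp: assms(2) dest: nodes_args)

lemma (in operator_system) det_system_eq_0_iff:
  fixes T :: "nat \<Rightarrow> nat \<Rightarrow> nat \<Rightarrow> 'a::field"
  assumes h: "bij_betw h {..<M} N"
  shows "det (pencil_at 3 M (\<lambda>l r s. coef C l (h r) (h s)) d T) = 0 \<longleftrightarrow>
    (\<exists>V. (\<exists>e\<in>N. \<exists>p<d. V e p \<noteq> 0) \<and>
      (\<forall>e\<in>N. \<forall>p<d. residual C (\<lambda>l f. \<Sum>q<d. T l p q * V f q) e = 0))"
    (is "?det \<longleftrightarrow> (\<exists>V. ?P V)")
proof -
  have img: "h ` {..<M} = N" using h by (rule bij_betw_imp_surj_on)
  have sum: "(\<Sum>s<M. \<Sum>l<3. coef C l (h r) (h s) * Y l (h s)) = residual C Y (h r)"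
    if "r < M" for r and Y :: "nat \<Rightarrow> expr \<Rightarrow> 'a"
  proof -
    have "(\<Sum>s<M. \<Sum>l<3. coef C l (h r) (h s) * Y l (h s)) = (\<Sum>f\<in>N. \<Sum>l<3. coef C l (h r) f * Y l f)"
      by (rule sum.reindex_bij_betw[OF h, of "\<lambda>f. \<Sum>l<3. coef C l (h r) f * Y l f"])
    also have "\<dots> = residual C Y (h r)" using img that by (intro residual_as_sum) blast
    finally show ?thesis .
  qed
  show ?thesis
  proof
    assume ?det
    then obtain V where V: "\<exists>s<M. \<exists>p<d. V s p \<noteq> 0" and sol: "\<And>r p. r < M \<Longrightarrow> p < d \<Longrightarrow>
        (\<Sum>s<M. \<Sum>l<3. coef C l (h r) (h s) * (\<Sum>q<d. T l p q * V s q)) = 0"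
      unfolding det_pencil_at_eq_0_iff by blast
    define V' where "V' e = V (inv_into {..<M} h e)" for e
    have V': "V' (h s) = V s" if "s < M" for s
      using that h by (simp add: V'_def bij_betw_inv_into_left)
    have "residual C (\<lambda>l f. \<Sum>q<d. T l p q * V' f q) (h r) = 0" if "r < M" "p < d" for r p
      using sol[OF that] by (subst sum[OF that(1), symmetric]) (simp add: V')
    moreover have "\<exists>e\<in>N. \<exists>p<d. V' e p \<noteq> 0"
      using V V' img by (metis imageI lessThan_iff)
    ultimately show "\<exists>V. ?P V"
      unfolding img[symmetric] by (intro exI[of _ V']) blast
  next
    assume "\<exists>V. ?P V"
    then obtain V where V: "\<exists>e\<in>N. \<exists>p<d. V e p \<noteq> 0"
      and sol: "\<And>e p. e \<in> N \<Longrightarrow> p < d \<Longrightarrow> residual C (\<lambda>l f. \<Sum>q<d. T l p q * V f q) e = 0" by blast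
    have "\<exists>s<M. \<exists>p<d. V (h s) p \<noteq> 0" using V unfolding img[symmetric] by blast
    moreover have "(\<Sum>s<M. \<Sum>l<3. coef C l (h r) (h s) * (\<Sum>q<d. T l p q * V (h s) q)) = 0"
      if "r < M" "p < d" for r p
      using sum[OF that(1), of "\<lambda>l f. \<Sum>q<d. T l p q * V f q"] sol[of "h r" p] img that by auto
    ultimately show ?det unfolding det_pencil_at_eq_0_iff by (intro exI[of _ "V \<circ> h"]) simp
  qed
qed

section \<open>A rational identity for three by three matrices\<close>

text \<open>The identity is a computation with noncommutative products, for which a type that is an
  instance of \<^class>\<open>ring_1\<close> is convenient.  The entries are listed row by row.\<close>

datatype 'a mat3 = Mat3 'a 'a 'a 'a 'a 'a 'a 'a 'a

instantiation mat3 :: (comm_ring_1) ring_1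
begin

definition zero_mat3 :: "'a mat3" where "0 = Mat3 0 0 0 0 0 0 0 0 0"
definition one_mat3 :: "'a mat3" where "1 = Mat3 1 0 0 0 1 0 0 0 1"

fun plus_mat3 :: "'a mat3 \<Rightarrow> 'a mat3 \<Rightarrow> 'a mat3" where
  "Mat3 a b c d e f g h i + Mat3 a' b' c' d' e' f' g' h' i' =
    Mat3 (a + a') (b + b') (c + c') (d + d') (e + e') (f + f') (g + g') (h + h') (i + i')"

fun uminus_mat3 :: "'a mat3 \<Rightarrow> 'a mat3" where
  "- Mat3 a b c d e f g h i = Mat3 (- a) (- b) (- c) (- d) (- e) (- f) (- g) (- h) (- i)"

fun minus_mat3 :: "'a mat3 \<Rightarrow> 'a mat3 \<Rightarrow> 'a mat3" where
  "Mat3 a b c d e f g h i - Mat3 a' b' c' d' e' f' g' h' i' =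
    Mat3 (a - a') (b - b') (c - c') (d - d') (e - e') (f - f') (g - g') (h - h') (i - i')"

fun times_mat3 :: "'a mat3 \<Rightarrow> 'a mat3 \<Rightarrow> 'a mat3" where
  "Mat3 a b c d e f g h i * Mat3 a' b' c' d' e' f' g' h' i' =
    Mat3 (a * a' + b * d' + c * g') (a * b' + b * e' + c * h') (a * c' + b * f' + c * i')
         (d * a' + e * d' + f * g') (d * b' + e * e' + f * h') (d * c' + e * f' + f * i')
         (g * a' + h * d' + i * g') (g * b' + h * e' + i * h') (g * c' + h * f' + i * i')"

instance
proof
  fix A B C :: "'a mat3"
  show "A + B + C = A + (B + C)" by (cases A; cases B; cases C) (simp add: add.assoc)
  show "A + B = B + A" by (cases A; cases B) (simp add: add.commute)
  show "0 + A = A" by (cases A) (simp add: zero_mat3_def)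
  show "- A + A = 0" by (cases A) (simp add: zero_mat3_def)
  show "A - B = A + - B" by (cases A; cases B) simp
  show "A * B * C = A * (B * C)" by (cases A; cases B; cases C) (simp add: algebra_simps)
  show "1 * A = A" by (cases A) (simp add: one_mat3_def)
  show "A * 1 = A" by (cases A) (simp add: one_mat3_def)
  show "(A + B) * C = A * C + B * C" by (cases A; cases B; cases C) (simp add: algebra_simps)
  show "A * (B + C) = A * B + A * C" by (cases A; cases B; cases C) (simp add: algebra_simps)
  show "(0 :: 'a mat3) \<noteq> 1" by (simp add: zero_mat3_def one_mat3_def)
qed

end

definition scalar3 :: "'a::comm_ring_1 \<Rightarrow> 'a mat3" where
  "scalar3 c = Mat3 c 0 0 0 c 0 0 0 c"

fun trace3 :: "'a::comm_ring_1 mat3 \<Rightarrow> 'a" where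
  "trace3 (Mat3 a b c d e f g h i) = a + e + i"

fun minors3 :: "'a::comm_ring_1 mat3 \<Rightarrow> 'a" where
  "minors3 (Mat3 a b c d e f g h i) = a * e - b * d + (a * i - c * g) + (e * i - f * h)"

fun det3 :: "'a::comm_ring_1 mat3 \<Rightarrow> 'a" where
  "det3 (Mat3 a b c d e f g h i) =
    a * (e * i - f * h) - b * (d * i - f * g) + c * (d * h - e * g)"

fun adj3 :: "'a::comm_ring_1 mat3 \<Rightarrow> 'a mat3" where
  "adj3 (Mat3 a b c d e f g h i) =
    Mat3 (e * i - f * h) (c * h - b * i) (b * f - c * e)
         (f * g - d * i) (a * i - c * g) (c * d - a * f)
         (d * h - e * g) (b * g - a * h) (a * e - b * d)"

lemma scalar3_diff: "scalar3 (x - y) = scalar3 x - scalar3 y"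
  and scalar3_uminus: "scalar3 (- x) = - scalar3 x"
  by (simp_all add: scalar3_def)

lemma scalar3_commute: "M * scalar3 c = scalar3 c * M"
  by (cases M) (simp add: scalar3_def mult.commute)

lemma trace3_linear:
  "trace3 (M + N) = trace3 M + trace3 N" "trace3 (- M) = - trace3 M"
  "trace3 (M - N) = trace3 M - trace3 N" "trace3 (scalar3 c) = 3 * c"
  by (cases M; cases N; simp add: scalar3_def)+

lemma trace3_mult_commute: "trace3 (M * N) = trace3 (N * M)"
  by (cases M; cases N) (simp add: algebra_simps)

lemma trace3_square: "trace3 (M * M) = trace3 M * trace3 M - 2 * minors3 M"
  by (cases M) (simp add: algebra_simps)

lemma cayley_hamilton3:
  "M * M * M - scalar3 (trace3 M) * M * M + scalar3 (minors3 M) * M = scalar3 (det3 M)"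
  by (cases M) (simp add: scalar3_def algebra_simps)

text \<open>The part of Cayley--Hamilton for $M + s N$ that is linear in $s$; the scalar is
  $\mathrm{tr}(\mathrm{adj}(M) N)$, the derivative of the determinant at \<open>M\<close> in the direction \<open>N\<close>.\<close>

lemma polarised_cayley_hamilton3:
  "\<exists>c. M * M * N + M * N * M + N * M * M
    - scalar3 (trace3 M) * (M * N + N * M) - scalar3 (trace3 N) * M * M
    + scalar3 (minors3 M) * N + scalar3 (trace3 M * trace3 N - trace3 (M * N)) * M = scalar3 c"
  by (rule exI[of _ "trace3 (adj3 M * N)"], cases M; cases N)
     (simp add: scalar3_def algebra_simps)

lemma adj3: "M * adj3 M = scalar3 (det3 M)" "adj3 M * M = scalar3 (det3 M)"
  by (cases M; simp add: scalar3_def algebra_simps)+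

text \<open>For a singular nonzero \<open>M\<close> the adjugate is annihilated by \<open>M\<close>.  If the adjugate vanishes, all rows of
  \<open>M\<close> are proportional, and the vectors orthogonal to one nonzero row are in the kernel.\<close>

lemma invertible_or_zero_divisor3:
  fixes M :: "'a::field mat3"
  obtains M' where "M * M' = 1" "M' * M = 1" | K where "K \<noteq> 0" "M * K = 0"
proof (cases "det3 M = 0")
  case False
  have "M * (scalar3 (1 / det3 M) * adj3 M) = 1" "scalar3 (1 / det3 M) * adj3 M * M = 1"
    using False adj3[of M]
    by (simp_all add: mult.assoc[symmetric] scalar3_commute)
       (simp_all add: mult.assoc, simp_all add: scalar3_def one_mat3_def)
  then show ?thesis using that(1) by blast
next
  case det: True
  show ?thesis
  proof (cases "adj3 M = 0")
    case False
    then show ?thesis using that(2)[of "adj3 M"] adj3(1)[of M] det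
      by (simp add: scalar3_def zero_mat3_def)
  next
    case adj: True
    obtain a b c d e f g h i where M: "M = Mat3 a b c d e f g h i" by (cases M)
    \<comment> \<open>The columns are $(p, -r, 0)$, $(q, 0, -r)$ and $(0, q, -p)$, which span the vectors orthogonal to $(r, p, q)$.\<close>
    have rows: "M * Mat3 p q 0 (- r) 0 q 0 (- r) (- p) = 0"
      if "(r, p, q) \<in> {(a, b, c), (d, e, f), (g, h, i)}" for r p q
      using that adj by (auto simp: M zero_mat3_def algebra_simps)
    show ?thesis
    proof (cases "M = 0")
      case True
      then show ?thesis using that(2)[of 1] by simp
    next
      case False
      then obtain r p q where "(r, p, q) \<in> {(a, b, c), (d, e, f), (g, h, i)}"
        "r \<noteq> 0 \<or> p \<noteq> 0 \<or> q \<noteq> 0"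
        by (auto simp: M zero_mat3_def)
      then show ?thesis using that(2)[OF _ rows[of r p q]] by (auto simp: zero_mat3_def)
    qed
  qed
qed

text \<open>Here \<open>s\<close> and \<open>\<delta>\<close> are the scalar coefficients of the characteristic polynomial of \<open>u\<close>, which is
  also that of the conjugate \<open>v\<close>.  The two Cayley--Hamilton equations rewrite the cubes and the relation \<open>quad\<close>
  rewrites $v^2 u$ on the left hand side; what remains is the polarised Cayley--Hamilton expression of \<open>u\<close> and \<open>v\<close>.\<close>

lemma degree_three_identity:
  fixes A B W' :: "'a::field mat3"
  defines "u \<equiv> A * B - B * A"
  defines "w \<equiv> u * A - A * u"
  assumes inv: "w * W' = 1" "W' * w = 1"
  defines "v \<equiv> W' * u * w"
  shows "\<exists>c. v * v * (v + u) - u * (u * (v + u) + v * u) = scalar3 c"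
proof -
  define s \<delta> where "s = scalar3 (minors3 u)" and "\<delta> = scalar3 (det3 u)"
  have sc: "M * s = s * M" "M * \<delta> = \<delta> * M" for M
    by (simp_all add: s_def \<delta>_def scalar3_commute)
  have w_v: "w * v = u * w" by (simp add: v_def mult.assoc[symmetric] inv)
  have tr_u: "trace3 u = 0"
    by (simp add: u_def trace3_linear trace3_mult_commute)
  have tr_conj: "trace3 (W' * M * w) = trace3 M" for M
    by (subst trace3_mult_commute) (simp add: mult.assoc[symmetric] inv)
  have vv: "v * v = W' * (u * u) * w"
  proof -
    have "v * v = W' * u * (w * W') * u * w" by (simp only: v_def mult.assoc)
    then show ?thesis by (simp add: inv mult.assoc)
  qed
  have tr_v: "trace3 v = 0" "trace3 (v * v) = trace3 (u * u)"
    using tr_conj[of u] tr_conj[of "u * u"] tr_u by (simp_all add: vv) (simp add: v_def)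
  \<comment> \<open>Cayley--Hamilton for \<open>u\<close>, and its conjugate by \<open>w\<close>.\<close>
  have ch_u: "u * u * u + s * u = \<delta>"
    using cayley_hamilton3[of u] by (simp add: tr_u s_def \<delta>_def scalar3_def flip: zero_mat3_def)
  have ch_v: "v * v * v + s * v = \<delta>"
  proof -
    have "w * (v * v * v) = u * u * u * w"
      by (metis w_v mult.assoc)
    then have "w * (v * v * v + s * v) = (u * u * u + s * u) * w"
      by (simp add: distrib_left distrib_right w_v mult.assoc[symmetric] sc) (simp add: mult.assoc w_v)
    then have "W' * (w * (v * v * v + s * v)) = W' * (w * \<delta>)"
      by (simp add: ch_u sc)
    then show ?thesis by (simp add: mult.assoc[symmetric] inv)
  qed
  have quad: "v * v + v * u + u * u = - s"
  proof -
    \<comment> \<open>Commuting with \<open>A\<close> is a derivation that maps \<open>u\<close> to \<open>w\<close>; then \<open>w\<close> is moved to the left by \<open>w v = u w\<close>.\<close>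
    have "0 = (u * u * u + s * u) * A - A * (u * u * u + s * u)"
      by (simp add: ch_u sc)
    also have "\<dots> = w * u * u + u * w * u + u * u * w + s * w"
      by (simp add: w_def algebra_simps sc)
         (simp add: sc mult.assoc[symmetric])
    also have "\<dots> = w * (v * v + v * u + u * u + s)"
      by (simp add: distrib_left mult.assoc[symmetric] w_v sc) (simp add: mult.assoc w_v)
    finally have "W' * (w * (v * v + v * u + u * u + s)) = 0" by simp
    then have "v * v + v * u + u * u + s = 0" by (simp add: mult.assoc[symmetric] inv)
    then show ?thesis by (simp add: eq_neg_iff_add_eq_0)
  qed
  \<comment> \<open>Taking traces in \<open>quad\<close>: $-2\sigma + \mathrm{tr}(v u) - 2\sigma = -3\sigma$.\<close>
  have tr_uv: "trace3 (u * v) = minors3 u"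
    using arg_cong[OF quad, of trace3] trace3_square[of u]
    by (simp add: trace3_linear tr_v tr_u s_def trace3_mult_commute[of v u]) algebra
  obtain c where "u * u * v + u * v * u + v * u * u + s * v - s * u = scalar3 c"
    using polarised_cayley_hamilton3[of u v]
    by (auto simp: tr_u tr_v tr_uv s_def scalar3_uminus scalar3_def[of 0] simp flip: zero_mat3_def)
  moreover have "v * v * (v + u) - u * (u * (v + u) + v * u)
      = - \<delta> - (u * u * v + u * v * u + v * u * u + s * v - s * u)"
  proof -
    have 1: "v * v * v = \<delta> - s * v" "u * u * u = \<delta> - s * u" using ch_u ch_v by (simp_all add: algebra_simps)
    have "v * v = - s - v * u - u * u" using quad by (simp add: algebra_simps)
    then have "v * v * u = (- s - v * u - u * u) * u" by simp
    then have 2: "v * v * u = - (s * u) - v * u * u - u * u * u" by (simp add: left_diff_distrib)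
    have "v * v * (v + u) - u * (u * (v + u) + v * u)
        = v * v * v + v * v * u - u * u * v - u * u * u - u * v * u"
      by (simp add: algebra_simps)
    then show ?thesis unfolding 1 2 by (simp add: algebra_simps)
  qed
  ultimately show ?thesis
    by (intro exI[of _ "- det3 u - c"]) (simp add: \<delta>_def scalar3_diff scalar3_uminus)
qed

fun entry3 :: "'a mat3 \<Rightarrow> nat \<Rightarrow> nat \<Rightarrow> 'a" where
  "entry3 (Mat3 a b c d e f g h i) p q = [[a, b, c], [d, e, f], [g, h, i]] ! p ! q"

lemma less_3_cases: "p < 3 \<Longrightarrow> (p::nat) = 0 \<or> p = 1 \<or> p = 2"
  by auto

lemma entry3_residual:
  assumes "p < 3" "q < 3"
  shows "residual C (\<lambda>l e. entry3 (Y l e) p q) e = entry3 (residual C Y e) p q"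
proof -
  have "entry3 (M + M') p q = entry3 M p q + entry3 M' p q"
    "entry3 (M - M') p q = entry3 M p q - entry3 M' p q" for M M' :: "'a mat3"
    using assms by (cases M; cases M'; auto dest!: less_3_cases)+
  then show ?thesis by (cases e) simp_all
qed

lemma entry3_mult:
  fixes M M' :: "'a::comm_ring_1 mat3"
  assumes "p < 3" "q < 3"
  shows "entry3 (M * M') p q = (\<Sum>k<3. entry3 M p k * entry3 M' k q)"
proof -
  have "(\<Sum>k<3. g k) = g 0 + g 1 + g 2" for g :: "nat \<Rightarrow> 'a"
    by (simp add: eval_nat_numeral)
  then show ?thesis using assms by (cases M; cases M') (auto dest!: less_3_cases)
qed

lemma entry3_zero: "M = 0 \<longleftrightarrow> (\<forall>p<3. \<forall>q<3. entry3 M p q = 0)"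
proof
  assume "M = 0"
  then show "\<forall>p<3. \<forall>q<3. entry3 M p q = 0" by (auto simp: zero_mat3_def dest!: less_3_cases)
next
  assume *: "\<forall>p<3. \<forall>q<3. entry3 M p q = 0"
  show "M = 0"
    using *[rule_format, of 0 0] *[rule_format, of 0 1] *[rule_format, of 0 2]
      *[rule_format, of 1 0] *[rule_format, of 1 1] *[rule_format, of 1 2]
      *[rule_format, of 2 0] *[rule_format, of 2 1] *[rule_format, of 2 2]
    by (cases M) (simp add: zero_mat3_def)
qed

section \<open>The system and its solutions in degrees two and three\<close>

text \<open>On the values of expressions, \<open>bracket\<close> is multiplication by $u = [A, B]$ and
  \<open>double_bracket\<close> is multiplication by $w = [u, A]$.\<close>

definition bracket :: "expr \<Rightarrow> expr" where
  "bracket e = Minus (Apply True (Apply False e)) (Apply False (Apply True e))"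

definition double_bracket :: "expr \<Rightarrow> expr" where
  "double_bracket e = Minus (bracket (Apply True e)) (Apply True (bracket e))"

text \<open>If $z = v y$, $z' = v u y$ and $q = v^2 (v + u) y$, this is $\kappa y$.\<close>

definition kappa :: "expr \<Rightarrow> expr \<Rightarrow> expr \<Rightarrow> expr \<Rightarrow> expr" where
  "kappa y z z' q = Minus q (bracket (Plus (bracket (Plus z (bracket y))) z'))"

text \<open>The unknowns $0, \ldots, 7$ are $y, z, z', q, z_1, z_1', q_1, n$.  If \<open>w\<close> is invertible, the
  first three equations say $z = v y$, $z' = v u y$ and $q = v^2 (v + u) y$, the next three say the
  same for \<open>A y\<close> in place of \<open>y\<close>, and the seventh is $\kappa A y = A \kappa y$.  The last equation,
  $w n = 0$, makes the system singular whenever \<open>w\<close> is.\<close>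

definition constraints :: "expr list" where
  "constraints = (let y = Unknown 0; y' = Apply True y in
    [Minus (double_bracket (Unknown 1)) (bracket (double_bracket y)),
     Minus (double_bracket (Unknown 2)) (bracket (double_bracket (bracket y))),
     Minus (double_bracket (Unknown 3))
       (bracket (bracket (double_bracket (Plus (Unknown 1) (bracket y))))),
     Minus (double_bracket (Unknown 4)) (bracket (double_bracket y')),
     Minus (double_bracket (Unknown 5)) (bracket (double_bracket (bracket y'))),
     Minus (double_bracket (Unknown 6))
       (bracket (bracket (double_bracket (Plus (Unknown 4) (bracket y'))))),
     Minus (kappa y' (Unknown 4) (Unknown 5) (Unknown 6))
       (Apply True (kappa y (Unknown 1) (Unknown 2) (Unknown 3))),
     double_bracket (Unknown 7)])"

lemma Unknown_subexprs_macros: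
  "Unknown k \<in> subexprs (bracket e) \<longleftrightarrow> Unknown k \<in> subexprs e"
  "Unknown k \<in> subexprs (double_bracket e) \<longleftrightarrow> Unknown k \<in> subexprs e"
  "Unknown k \<in> subexprs (kappa y z z' q) \<longleftrightarrow>
    Unknown k \<in> subexprs y \<union> subexprs z \<union> subexprs z' \<union> subexprs q"
  by (auto simp: bracket_def double_bracket_def kappa_def)

lemma length_constraints: "length constraints = 8"
  by (simp add: constraints_def Let_def)

interpretation gap: operator_system 8 "\<lambda>j. constraints ! j"
proof
  show "k < 8" if "j < 8" "Unknown k \<in> subexprs (constraints ! j)" for j k
  proof -
    have "\<forall>c \<in> set constraints. Unknown k \<in> subexprs c \<longrightarrow> k < 8"
      by (simp add: constraints_def Let_def Unknown_subexprs_macros)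
    moreover have "constraints ! j \<in> set constraints" using that(1) length_constraints by simp
    ultimately show ?thesis using that(2) by blast
  qed
qed simp

text \<open>The solution is sought among matrices, on which \<open>A\<close> and \<open>B\<close> act by left multiplication; each of
  its columns is then a solution among vectors.  If \<open>w\<close> is invertible, start with $y = 1$; the seventh equation is
  the centrality of \<open>\<kappa>\<close>.\<close>

lemma three_by_three_solution:
  fixes A B :: "'a::field mat3"
  obtains v where "\<forall>c\<in>set constraints. eval (\<lambda>b M. (if b then A else B) * M) v c = 0"
    "\<exists>j<8. v j \<noteq> 0"
proof -
  let ?f = "\<lambda>b M. (if b then A else B) * M"
  define u w where "u = A * B - B * A" and "w = u * A - A * u"
  have U: "eval ?f v (bracket e) = u * eval ?f v e" for v e
    by (simp add: bracket_def u_def left_diff_distrib mult.assoc)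
  have W: "eval ?f v (double_bracket e) = w * eval ?f v e" for v e
    by (simp add: double_bracket_def U w_def left_diff_distrib mult.assoc)
  consider w' where "w * w' = 1" "w' * w = 1" | k where "k \<noteq> 0" "w * k = 0"
    by (rule invertible_or_zero_divisor3)
  then show ?thesis
  proof cases
    case 2
    show ?thesis
      by (rule that[of "\<lambda>j. if j = 7 then k else 0"])
         (use 2 in \<open>simp_all add: constraints_def Let_def U W kappa_def\<close>)
  next
    case 1
    define t where "t = w' * u * w"
    have wt: "w * (t * M) = u * (w * M)" for M
      using 1 by (simp add: t_def mult.assoc[symmetric])
    obtain c where c: "t * t * (t + u) - u * (u * (t + u) + t * u) = scalar3 c"
      using degree_three_identity[of A B w'] 1 by (auto simp: u_def w_def t_def)
    \<comment> \<open>The conjugate called \<open>v\<close> above is \<open>t\<close> here, and \<open>v\<close> assigns the unknowns.\<close>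
    define v where "v = (!) [1, t, t * u, t * t * (t + u), t * A, t * u * A, t * t * (t + u) * A, 0]"
    have v: "v 0 = 1" "v 1 = t" "v 2 = t * u" "v 3 = t * t * (t + u)" "v 4 = t * A"
      "v 5 = t * u * A" "v 6 = t * t * (t + u) * A" "v 7 = 0" "v (Suc 0) = t"
      by (simp_all add: v_def)
    have K0: "eval ?f v (kappa (Unknown 0) (Unknown 1) (Unknown 2) (Unknown 3)) = scalar3 c"
      by (simp add: kappa_def U v flip: c)
    have "eval ?f v (kappa (Apply True (Unknown 0)) (Unknown 4) (Unknown 5) (Unknown 6))
        = (t * t * (t + u) - u * (u * (t + u) + t * u)) * A"
      by (simp add: kappa_def U v algebra_simps)
    then have K1: "eval ?f v (kappa (Apply True (Unknown 0)) (Unknown 4) (Unknown 5) (Unknown 6)) = scalar3 c * A"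
      by (simp only: c)
    have "w * t = u * w" using wt[of 1] by simp
    then have "\<forall>c\<in>set constraints. eval ?f v c = 0"
      by (simp add: constraints_def Let_def U W K0[simplified] K1[simplified] v wt mult.assoc distrib_right distrib_left scalar3_commute[of A])
    moreover have "v 0 \<noteq> 0" by (simp add: v)
    ultimately show ?thesis using that[of v] by (metis zero_less_numeral)
  qed
qed

text \<open>The operators are $A = E_{11}$ and the coordinate swap $B$.  Then \<open>u\<close> maps $(x, y)$ to $(y, -x)$ and
  \<open>w\<close> maps $(x, y)$ to $(-y, -x)$.  The seventh equation becomes $[A, u] y = 0$, whose only
  solution is zero; all other unknowns are determined by \<open>y\<close> as \<open>w\<close> is invertible.\<close>

lemma two_by_two_solution_trivial:
  fixes v :: "nat \<Rightarrow> 'a::field \<times> 'a"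
  defines "f \<equiv> \<lambda>b z. if b then (fst z, 0) else (snd z, fst z)"
  assumes v: "\<forall>c\<in>set constraints. eval f v c = 0"
  shows "\<forall>j<8. v j = 0"
proof -
  have f: "f True z = (fst z, 0)" "f False z = (snd z, fst z)" for z
    by (simp_all add: f_def)
  have U: "eval f v (bracket e) = (snd (eval f v e), - fst (eval f v e))" for e
    by (simp add: bracket_def f)
  have W: "eval f v (double_bracket e) = (- snd (eval f v e), - fst (eval f v e))" for e
    by (simp add: double_bracket_def U) (simp add: f)
  note eqs = v[unfolded constraints_def Let_def kappa_def, simplified, unfolded prod_eq_iff U W f, simplified]
  have "fst (v 0) = 0" and v1: "- fst (v 1) = snd (v 0)" and "2 * snd (v 0) + fst (v 1) = 0"
    using eqs by (auto simp: U W f)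
  moreover have "fst (v 1) = - snd (v 0)" using v1 by (metis minus_minus)
  ultimately have "v 0 = 0" by (simp add: prod_eq_iff)
  then have "v j = 0" if "j \<in> {0, 1, 2, 3, 4, 5, 6, 7}" for j
    using that eqs by (auto simp: U W f prod_eq_iff)
  moreover have "{..<8} = {0, 1, 2, 3, 4, 5, 6, 7 :: nat}" by auto
  ultimately show ?thesis by blast
qed

abbreviation "gap_residual \<equiv> residual (\<lambda>j. constraints ! j)"

lemma three_by_three_system_singular:
  fixes X :: "nat \<Rightarrow> 'a::field mat3"
  obtains V where "\<And>e. e \<in> gap.N \<Longrightarrow> gap_residual (\<lambda>l f. X l * V f) e = 0"
    "\<exists>e\<in>gap.N. V e \<noteq> 0"
proof -
  consider Z where "X 0 * Z = 1" "Z * X 0 = 1" | k where "k \<noteq> 0" "X 0 * k = 0"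
    by (rule invertible_or_zero_divisor3)
  then show ?thesis
  proof cases
    case 2
    show ?thesis
      by (rule gap.singular_homogeniser_solution[of k "(*) (X 0)" "\<lambda>l. (*) (X l)"])
         (use 2 that in auto)
  next
    case 1
    let ?f = "\<lambda>b M. (if b then Z * X 1 else Z * X 2) * M"
    obtain v where v: "\<forall>c\<in>set constraints. eval ?f v c = 0" "\<exists>j<8. v j \<noteq> 0"
      by (rule three_by_three_solution)
    have X: "X (slot b) * M = X 0 * ?f b M" for b M
      using 1 by (simp add: slot_def mult.assoc[symmetric])
    have "gap_residual (\<lambda>l f. X l * eval ?f v f) e = 0" if "e \<in> gap.N" for e
    proof (rule gap.eval_solution[where f = ?f and v = v and g = "(*) (X 0)"])
      show "eval ?f v (constraints ! j) = 0" if "j < 8" for j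
        using v(1) that length_constraints by simp
      show "X (slot b) * eval ?f v e = X 0 * ?f b (eval ?f v e)" for b e by (rule X)
    qed (use that in \<open>simp_all add: distrib_left\<close>)
    moreover have "\<exists>e\<in>gap.N. eval ?f v e \<noteq> 0"
      using v(2) gap.Unknown_node by (metis eval.simps(1))
    ultimately show ?thesis by (rule that)
  qed
qed

lemma residual_Pair: "residual C (\<lambda>l e. (f l e, g l e)) e = (residual C f e, residual C g e)"
  by (cases e) simp_all

text \<open>The triple $(1, E_{11}, B)$ with \<open>B\<close> the coordinate swap.\<close>

definition regular_point :: "nat \<Rightarrow> nat \<Rightarrow> nat \<Rightarrow> 'a::field" where
  "regular_point l p q = (if l = 0 then of_bool (p = q)
    else if l = 1 then of_bool (p = 0 \<and> q = 0) else of_bool (p \<noteq> q))"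

lemma two_by_two_system_regular:
  fixes V :: "expr \<Rightarrow> nat \<Rightarrow> 'a::field"
  assumes sol: "\<And>e p. e \<in> gap.N \<Longrightarrow> p < 2 \<Longrightarrow> gap_residual (\<lambda>l f. \<Sum>q<2. regular_point l p q * V f q) e = 0"
    and "e \<in> gap.N" "p < 2"
  shows "V e p = 0"
proof -
  let ?f = "\<lambda>b z. if b then (fst z, 0) else (snd z, fst z)"
  define vals where "vals e = (V e 0, V e 1)" for e
  define Y where "Y l e = (\<Sum>q<2. regular_point l 0 q * V e q, \<Sum>q<2. regular_point l 1 q * V e q)" for l e
  have sum2: "(\<Sum>q<2. g q) = g 0 + g 1" for g :: "nat \<Rightarrow> 'a"
    by (simp add: eval_nat_numeral)
  have rows: "gap_residual Y e = 0" if "e \<in> gap.N" for e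
    unfolding Y_def residual_Pair using sol[OF that, of 0] sol[OF that, of 1] by (simp add: zero_prod_def)
  have Y: "Y 0 e = vals e" "Y (slot b) e = ?f b (vals e)" for b e
    by (simp_all add: Y_def vals_def regular_point_def sum2 slot_def)
  have "eval ?f (\<lambda>j. vals (Unknown j)) (constraints ! j) = 0" if "j < 8" for j
    by (rule gap.solution_imp_eval(2)[OF rows Y that])
  then have "\<forall>c\<in>set constraints. eval ?f (\<lambda>j. vals (Unknown j)) c = 0"
    by (auto simp: in_set_conv_nth length_constraints)
  then have "\<forall>j<8. vals (Unknown j) = 0" by (rule two_by_two_solution_trivial)
  then have "eval ?f (\<lambda>j. vals (Unknown j)) e = 0"
    using \<open>e \<in> gap.N\<close> by (intro gap.eval_zero) (auto simp: zero_prod_def)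
  then have "vals e = 0"
    using gap.solution_imp_eval(1)[OF rows Y \<open>e \<in> gap.N\<close>] by simp
  with \<open>p < 2\<close> show ?thesis by (auto simp: vals_def zero_prod_def less_2_cases_iff)
qed

section \<open>The gap between the two blow-ups\<close>

theorem proposition1p13:
  assumes "infinite (UNIV :: 'a::field set)"
  shows "\<exists>(k::nat) (l::nat) (\<X> :: 'a mat set).
    linear_subspace_of_matrices k l \<X> \<and>
    real (max_rank (blow_up k l 2 \<X>)) / 2 > real (max_rank (blow_up k l 3 \<X>)) / 3"
proof -
  define M where "M = card gap.N"
  obtain h where h: "bij_betw h {..<M} gap.N"
    using ex_bij_betw_nat_finite[OF finite_nodes] by (auto simp: M_def lessThan_atLeast0)
  define c :: "nat \<Rightarrow> nat \<Rightarrow> nat \<Rightarrow> 'a"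
    where "c = (\<lambda>l r s. coef (\<lambda>j. constraints ! j) l (h r) (h s))"
  have det_iff: "det (pencil_at 3 M c d T) = 0 \<longleftrightarrow>
      (\<exists>V. (\<exists>e\<in>gap.N. \<exists>p<d. V e p \<noteq> 0) \<and>
        (\<forall>e\<in>gap.N. \<forall>p<d. gap_residual (\<lambda>l f. \<Sum>q<d. T l p q * V f q) e = 0))" for d T
    unfolding c_def by (rule gap.det_system_eq_0_iff[OF h])
  have regular: "det (pencil_at 3 M c 2 regular_point) \<noteq> 0"
  proof
    assume "det (pencil_at 3 M c 2 regular_point) = 0"
    then obtain V :: "expr \<Rightarrow> nat \<Rightarrow> 'a" and e p where V: "e \<in> gap.N" "p < 2" "V e p \<noteq> 0"
      and sol: "\<forall>e\<in>gap.N. \<forall>p<2. gap_residual (\<lambda>l f. \<Sum>q<2. regular_point l p q * V f q) e = 0"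
      unfolding det_iff by (elim exE conjE bexE)
    have "V e p = 0"
      by (rule two_by_two_system_regular[OF _ V(1,2)]) (simp add: sol)
    with V(3) show False by contradiction
  qed
  have singular: "det (pencil_at 3 M c 3 T) = 0" for T
  proof -
    define X where "X l = Mat3 (T l 0 0) (T l 0 1) (T l 0 2) (T l 1 0) (T l 1 1) (T l 1 2)
      (T l 2 0) (T l 2 1) (T l 2 2)" for l
    have X: "entry3 (X l) p q = T l p q" if "p < 3" "q < 3" for l p q
      using that by (auto simp: X_def dest!: less_3_cases)
    obtain V where V: "\<And>e. e \<in> gap.N \<Longrightarrow> gap_residual (\<lambda>l f. X l * V f) e = 0"
      and "\<exists>e\<in>gap.N. V e \<noteq> 0"
      by (rule three_by_three_system_singular[of X]) blast
    then obtain e p q where nz: "e \<in> gap.N" "p < 3" "q < 3" "entry3 (V e) p q \<noteq> 0"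
      unfolding entry3_zero by blast
    have "gap_residual (\<lambda>l f. \<Sum>k<3. T l p' k * entry3 (V f) k q) e' = 0"
      if "e' \<in> gap.N" "p' < 3" for e' p'
    proof -
      have "(\<Sum>k<3. T l p' k * entry3 (V f) k q) = entry3 (X l * V f) p' q" for l f
        unfolding entry3_mult[OF that(2) nz(3)] by (intro sum.cong) (simp_all add: X that(2))
      then have "gap_residual (\<lambda>l f. \<Sum>k<3. T l p' k * entry3 (V f) k q) e'
          = entry3 (gap_residual (\<lambda>l f. X l * V f) e') p' q"
        by (simp add: entry3_residual[OF that(2) nz(3)])
      then show ?thesis using V[OF that(1)] entry3_zero[of "0 :: 'a mat3"] that(2) nz(3) by simp
    qed
    then show ?thesis
      unfolding det_iff using nz by (intro exI[of _ "\<lambda>f k. entry3 (V f) k q"] conjI ballI allI impI) auto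
  qed
  show ?thesis
    by (intro exI[of _ M] exI[of _ "pencil_space 3 M c"] conjI
        linear_subspace_pencil_space blow_up_rank_gap[OF regular singular])
qed

end
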